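(* Let $t\in\mathbb{N}$ (with $0\in\mathbb N$). There exists a constant $b_0$ such that, for $i=1,2$, $\operatorname{var}(g_{t,i}^b\mid\mathcal{F}_0)$ is a decreasing function of the mini-batch size $b$ for all $b\ge b_0$.
   Context: Online SGD on a two-layer linear network. Fixed ground-truth (teacher) matrices $W_1^*,W_2^*$ and student weights $W_1\in\mathbb{R}^{p_1\times p}$, $W_2\in\mathbb{R}^{p_2\times p_1}$ ($W_1^*,W_2^*$ have compatible sizes, with $W_2^*W_1^*\in\mathbb{R}^{p_2\times p}$); the loss is $\mathbb{E}_{x\sim N(0,I_p)}[\frac12\|W_2W_1x-W_2^*W_1^*x\|^2]$. For mini-batch size $b\ge1$, start from fixed $W_{0,1}^b=W_{0,1}$, $W_{0,2}^b=W_{0,2}$ independent of $b$. At each iteration $t\ge0$ draw fresh samples $x_{t,1},\dots,x_{t,b}$ i.i.d. from $N(0,I_p)$ (independent across iterations) and set $W_{t+1,i}^b=W_{t,i}^b-\alpha_t g_{t,i}^b$ for $i=1,2$, where, with $\mathcal{W}_t^b=W_{t,2}^bW_{t,1}^b-W_2^*W_1^*$, $$g_{t,1}^b=\frac1b\sum_{i=1}^b (W_{t,2}^b)^\top\mathcal{W}_t^b x_{t,i}x_{t,i}^\top,\qquad g_{t,2}^b=\frac1b\sum_{i=1}^b \mathcal{W}_t^b x_{t,i}x_{t,i}^\top (W_{t,1}^b)^\top .$$ The learning rates $\alpha_t>0$ are independent of $b$. $\mathcal{F}_0$ is the information consisting of the initial weights only. For a random matrix $Z$, $\operatorname{var}(Z\mid\mathcal{F}_0)=\mathbb{E}[\|\mathrm{vec}(Z)\|^2\mid\mathcal{F}_0]-\|\mathbb{E}[\mathrm{vec}(Z)\mid\mathcal{F}_0]\|^2$,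 a scalar, where $\mathrm{vec}$ is vectorization and $\|\cdot\|$ the Euclidean norm. "Decreasing" is in the non-strict sense (non-increasing). *)

theory Defs
  imports "HOL-Probability.Probability"
begin

text \<open>The density of \<open>N(0, I)\<close>, i.e. of a vector with independent standard normal components.\<close>

definition std_gaussian_density :: "real^'n \<Rightarrow> real" where
  "std_gaussian_density x = (\<Prod>k\<in>UNIV. std_normal_density (x $ k))"

text \<open>A matrix \<open>A \<in> \<real>\<^sup>m\<^sup>\<times>\<^sup>n\<close> has the type \<open>real^'n^'m\<close> (row index outermost).\<close>

definition vectorize :: "real^'n^'m \<Rightarrow> real^('m \<times> 'n)" where
  "vectorize A = (\<chi> k. A $ fst k $ snd k)"

definition outer_product :: "real^'m \<Rightarrow> real^'n \<Rightarrow> real^'n^'m" where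
  "outer_product x y = (\<chi> i j. x $ i * y $ j)"

text \<open>Conditional expectation of a random vector (taken componentwise) and the scalar conditional
  variance of a random matrix, given a sub-\<open>\<sigma>\<close>-algebra \<open>F\<close>. As usual, both are
  functions on the sample space that are determined up to null sets.\<close>

definition vec_cond_exp ::
    "'w measure \<Rightarrow> 'w measure \<Rightarrow> ('w \<Rightarrow> real^'n) \<Rightarrow> 'w \<Rightarrow> real^'n" where
  "vec_cond_exp M F Z \<omega> = (\<chi> k. real_cond_exp M F (\<lambda>\<omega>. Z \<omega> $ k) \<omega>)"

definition mat_cond_var ::
    "'w measure \<Rightarrow> 'w measure \<Rightarrow> ('w \<Rightarrow> real^'n^'m) \<Rightarrow> 'w \<Rightarrow> real" where
  "mat_cond_var M F Z \<omega> =
     real_cond_exp M F (\<lambda>\<omega>. (norm (vectorize (Z \<omega>)))\<^sup>2) \<omega>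
     - (norm (vec_cond_exp M F (\<lambda>\<omega>. vectorize (Z \<omega>)) \<omega>))\<^sup>2"

text \<open>\<open>V1\<close>, \<open>V2\<close> are the teacher matrices, \<open>W1\<close>, \<open>W2\<close> the student weights and
  \<open>x 1, \<dots>, x b\<close> the samples of the mini-batch. The hidden width \<open>'q\<close> of the teacher may differ
  from the hidden width \<open>'h\<close> of the student.\<close>

definition residual ::
    "real^'p^'q \<Rightarrow> real^'q^'o \<Rightarrow> real^'p^'h \<Rightarrow> real^'h^'o \<Rightarrow> real^'p^'o" where
  "residual V1 V2 W1 W2 = W2 ** W1 - V2 ** V1"

definition batch_grad1 ::
    "real^'p^'q \<Rightarrow> real^'q^'o \<Rightarrow> nat \<Rightarrow> (nat \<Rightarrow> real^'p) \<Rightarrow>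
     real^'p^'h \<Rightarrow> real^'h^'o \<Rightarrow> real^'p^'h" where
  "batch_grad1 V1 V2 b x W1 W2 =
     (1 / real b) *\<^sub>R
       (\<Sum>i=1..b. transpose W2 ** residual V1 V2 W1 W2 ** outer_product (x i) (x i))"

definition batch_grad2 ::
    "real^'p^'q \<Rightarrow> real^'q^'o \<Rightarrow> nat \<Rightarrow> (nat \<Rightarrow> real^'p) \<Rightarrow>
     real^'p^'h \<Rightarrow> real^'h^'o \<Rightarrow> real^'h^'o" where
  "batch_grad2 V1 V2 b x W1 W2 =
     (1 / real b) *\<^sub>R
       (\<Sum>i=1..b. residual V1 V2 W1 W2 ** outer_product (x i) (x i) ** transpose W1)"

text \<open>The SGD iterates \<open>(W\<^sub>1, W\<^sub>2)\<close> along one realisation of the samples: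
  \<open>x t i\<close> is the \<open>i\<close>-th sample of iteration \<open>t\<close>. Both layers are updated simultaneously.\<close>

primrec sgd_weights ::
    "real^'p^'q \<Rightarrow> real^'q^'o \<Rightarrow> real^'p^'h \<Rightarrow> real^'h^'o \<Rightarrow> (nat \<Rightarrow> real) \<Rightarrow>
     nat \<Rightarrow> (nat \<Rightarrow> nat \<Rightarrow> real^'p) \<Rightarrow> nat \<Rightarrow> (real^'p^'h) \<times> (real^'h^'o)" where
  "sgd_weights V1 V2 A1 A2 \<alpha> b x 0 = (A1, A2)"
| "sgd_weights V1 V2 A1 A2 \<alpha> b x (Suc t) =
     (let (W1, W2) = sgd_weights V1 V2 A1 A2 \<alpha> b x t in
       (W1 - \<alpha> t *\<^sub>R batch_grad1 V1 V2 b (x t) W1 W2,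
        W2 - \<alpha> t *\<^sub>R batch_grad2 V1 V2 b (x t) W1 W2))"

definition sgd_grad1 ::
    "real^'p^'q \<Rightarrow> real^'q^'o \<Rightarrow> real^'p^'h \<Rightarrow> real^'h^'o \<Rightarrow> (nat \<Rightarrow> real) \<Rightarrow>
     nat \<Rightarrow> (nat \<Rightarrow> nat \<Rightarrow> real^'p) \<Rightarrow> nat \<Rightarrow> real^'p^'h" where
  "sgd_grad1 V1 V2 A1 A2 \<alpha> b x t =
     (let (W1, W2) = sgd_weights V1 V2 A1 A2 \<alpha> b x t in batch_grad1 V1 V2 b (x t) W1 W2)"

definition sgd_grad2 ::
    "real^'p^'q \<Rightarrow> real^'q^'o \<Rightarrow> real^'p^'h \<Rightarrow> real^'h^'o \<Rightarrow> (nat \<Rightarrow> real) \<Rightarrow>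
     nat \<Rightarrow> (nat \<Rightarrow> nat \<Rightarrow> real^'p) \<Rightarrow> nat \<Rightarrow> real^'h^'o" where
  "sgd_grad2 V1 V2 A1 A2 \<alpha> b x t =
     (let (W1, W2) = sgd_weights V1 V2 A1 A2 \<alpha> b x t in batch_grad2 V1 V2 b (x t) W1 W2)"

text \<open>The \<open>\<sigma>\<close>-algebra generated by the initial weights. As these are deterministic, it is the
  \<open>\<sigma>\<close>-algebra generated by a constant random variable.\<close>

definition initial_sigma_algebra ::
    "'w measure \<Rightarrow> real^'p^'h \<Rightarrow> real^'h^'o \<Rightarrow> 'w measure" where
  "initial_sigma_algebra M A1 A2 = vimage_algebra (space M) (\<lambda>_. (A1, A2)) borel"

end

theory Submission
  imports Defs "HOL-Computational_Algebra.Polynomial"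
begin

text \<open>The entries of the gradients are polynomials, with coefficients independent of the batch size
  \<open>b\<close>, in the entries of the empirical second moment matrices \<open>S s = (1 / b) \<Sum>i x s i (x s i)\<^sup>T\<close>
  of the iterations \<open>s\<close>. The expectation of a monomial in these entries is a polynomial in
  \<open>1 / b\<close> whose constant term is the product of the expectations of the factors. Hence the
  variance of a gradient is a polynomial in \<open>1 / b\<close> with constant term \<open>0\<close>. As it is also
  nonnegative, it is nondecreasing in \<open>1 / b\<close> near \<open>0\<close>. Conditioning on the initial weights has no
  effect up to null sets because they are deterministic.\<close>

section \<open>Moments of sums of i.i.d. random vectors\<close>

text \<open>Powers of the set function \<open>\<nu>\<close> under subset convolution. If \<open>\<nu> B\<close> is the mixed moment of the
  components in \<open>B\<close> of a random vector, then \<open>conv_power \<nu> n L\<close> is the mixed moment of the components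
  in \<open>L\<close> of a sum of \<open>n\<close> independent copies.\<close>

primrec conv_power :: "('l set \<Rightarrow> real) \<Rightarrow> nat \<Rightarrow> 'l set \<Rightarrow> real" where
  "conv_power \<nu> 0 L = (if L = {} then 1 else 0)"
| "conv_power \<nu> (Suc n) L = (\<Sum>B\<in>Pow L. \<nu> B * conv_power \<nu> n (L - B))"

text \<open>The binomial theorem for \<open>\<nu> = \<delta> + (\<nu> - \<delta>)\<close>, where \<open>\<delta>\<close> is the unit of subset convolution.\<close>

lemma conv_power_binomial:
  assumes "finite L" "\<nu> {} = 1"
  shows "conv_power \<nu> n L = (\<Sum>k\<le>n. real (n choose k) * conv_power (\<nu>({} := 0)) k L)"
  using assms(1)
proof (induction n arbitrary: L)
  case 0
  then show ?case by simp
next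
  case (Suc n)
  let ?c = "conv_power (\<nu>({} := 0))"
  \<comment> \<open>The empty block has weight 0 in \<open>\<nu>({} := 0)\<close>, and on all other
    blocks the two set functions agree.\<close>
  have c_Suc: "?c (Suc k) L = (\<Sum>B\<in>Pow L - {{}}. \<nu> B * ?c k (L - B))" for k
    using Suc.prems by (auto intro!: sum.mono_neutral_cong_right split: if_splits)
  have "conv_power \<nu> (Suc n) L
      = conv_power \<nu> n L + (\<Sum>B\<in>Pow L - {{}}. \<nu> B * conv_power \<nu> n (L - B))"
    using Suc.prems assms(2) by (subst conv_power.simps, subst sum.remove[of _ "{}"]) auto
  also have "(\<Sum>B\<in>Pow L - {{}}. \<nu> B * conv_power \<nu> n (L - B))
      = (\<Sum>B\<in>Pow L - {{}}. \<Sum>k\<le>n. real (n choose k) * (\<nu> B * ?c k (L - B)))"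
  proof (intro sum.cong refl)
    fix B
    have "finite (L - B)" using Suc.prems by simp
    from Suc.IH[OF this]
    show "\<nu> B * conv_power \<nu> n (L - B) = (\<Sum>k\<le>n. real (n choose k) * (\<nu> B * ?c k (L - B)))"
      by (simp only: sum_distrib_left mult.left_commute[of "\<nu> B"])
  qed
  also have "\<dots> = (\<Sum>k\<le>n. real (n choose k) * ?c (Suc k) L)"
    unfolding c_Suc sum_distrib_left by (rule sum.swap)
  also have "conv_power \<nu> n L = (\<Sum>k\<le>n. real (n choose k) * ?c k L)"
    using Suc by blast
  also have "\<dots> = ?c 0 L + (\<Sum>k\<le>n. real (n choose Suc k) * ?c (Suc k) L)"
  proof -
    \<comment> \<open>The added term vanishes because \<open>n choose Suc n\<close> is 0; it aligns
      the range with the index shift.\<close>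
    have "(\<Sum>k\<le>n. real (n choose k) * ?c k L) = (\<Sum>k\<le>Suc n. real (n choose k) * ?c k L)"
      by simp
    also have "\<dots> = ?c 0 L + (\<Sum>k\<le>n. real (n choose Suc k) * ?c (Suc k) L)"
      by (subst sum.atMost_Suc_shift) simp
    finally show ?thesis .
  qed
  \<comment> \<open>Pascal's rule merges the two sums.\<close>
  also have "?c 0 L + (\<Sum>k\<le>n. real (n choose Suc k) * ?c (Suc k) L)
        + (\<Sum>k\<le>n. real (n choose k) * ?c (Suc k) L)
      = ?c 0 L + (\<Sum>k\<le>n. real (Suc n choose Suc k) * ?c (Suc k) L)"
    by (simp only: add.assoc flip: sum.distrib) (simp add: algebra_simps)
  also have "\<dots> = (\<Sum>k\<le>Suc n. real (Suc n choose k) * ?c k L)"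
    by (subst sum.atMost_Suc_shift) simp
  finally show ?case .
qed

text \<open>The power sums over ordered splittings of \<open>L\<close> into \<open>k\<close>
  disjoint blocks. When empty blocks have weight 0, a contributing splitting needs at least
  \<open>k\<close> elements.\<close>

lemma conv_power_eq_0:
  assumes "finite L" "\<nu> {} = 0" "card L < k"
  shows "conv_power \<nu> k L = 0"
  using assms(1,3)
proof (induction k arbitrary: L)
  case (Suc k)
  have "\<nu> B * conv_power \<nu> k (L - B) = 0" if "B \<in> Pow L" for B
  proof (cases "B = {}")
    case False
    with that Suc.prems have "card (L - B) < card L"
      by (intro psubset_card_mono) auto
    with Suc show ?thesis by simp
  qed (simp add: assms)
  then show ?case unfolding conv_power.simps by (intro sum.neutral) blast
qed auto

text \<open>With as many nonempty blocks as elements, every block is a singleton, so only the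
  orderings of \<open>L\<close> contribute.\<close>

lemma conv_power_card:
  assumes "finite L" "\<nu> {} = 0"
  shows "conv_power \<nu> (card L) L = fact (card L) * (\<Prod>l\<in>L. \<nu> {l})"
  using assms(1)
proof (induction "card L" arbitrary: L)
  case 0
  then show ?case by simp
next
  case (Suc k)
  have "conv_power \<nu> (Suc k) L = (\<Sum>B\<in>(\<lambda>l. {l}) ` L. \<nu> B * conv_power \<nu> k (L - B))"
    unfolding conv_power.simps
  proof (rule sum.mono_neutral_right)
    show "\<forall>B\<in>Pow L - (\<lambda>l. {l}) ` L. \<nu> B * conv_power \<nu> k (L - B) = 0"
    proof
      fix B assume B: "B \<in> Pow L - (\<lambda>l. {l}) ` L"
      show "\<nu> B * conv_power \<nu> k (L - B) = 0"
      proof (cases "B = {}")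
        case False
        then obtain l where l: "l \<in> B" by blast
        with B have "B \<noteq> {l}" by auto
        \<comment> \<open>A block with a second element besides \<open>l\<close> leaves fewer than
          \<open>k\<close> elements for the remaining \<open>k\<close> blocks.\<close>
        with l have "L - B \<subset> L - {l}" using B by blast
        then have "card (L - B) < card (L - {l})"
          using Suc by (intro psubset_card_mono) auto
        also have "\<dots> = k" using Suc l B by (auto simp: card_Diff_singleton_if)
        finally have "conv_power \<nu> k (L - B) = 0"
          using Suc assms by (intro conv_power_eq_0) auto
        then show ?thesis by simp
      qed (simp add: assms)
    qed
  qed (use Suc in auto)
  also have "\<dots> = (\<Sum>l\<in>L. \<nu> {l} * conv_power \<nu> k (L - {l}))"
    by (subst sum.reindex) auto
  also have "\<dots> = (\<Sum>l\<in>L. fact k * (\<Prod>l\<in>L. \<nu> {l}))"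
  proof (rule sum.cong)
    fix l assume l: "l \<in> L"
    have k: "k = card (L - {l})" using Suc l by simp
    show "\<nu> {l} * conv_power \<nu> k (L - {l}) = fact k * (\<Prod>l\<in>L. \<nu> {l})"
      using Suc(1)[OF k] Suc.prems l k by (simp add: prod.remove[of L l])
  qed simp
  also have "\<dots> = fact (Suc k) * (\<Prod>l\<in>L. \<nu> {l})"
    using Suc(2)[symmetric] by (simp add: algebra_simps)
  finally show ?case using Suc(2) by simp
qed

text \<open>The numerator n (n - 1) ... (n - k + 1) has \<open>k\<close> factors; dividing each by
  \<open>n\<close> leaves 1 - i / n.\<close>

lemma binomial_div_power_poly:
  obtains p :: "real poly"
  where "poly p 0 = 1 / fact k" "\<And>n. n \<ge> 1 \<Longrightarrow> real (n choose k) / real n ^ k = poly p (1 / real n)"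
proof
  let ?p = "smult (1 / fact k) (\<Prod>i=0..<k. [:1, - real i:])"
  show "poly ?p 0 = 1 / fact k" by (simp add: poly_prod)
  show "real (n choose k) / real n ^ k = poly ?p (1 / real n)" if "n \<ge> 1" for n
  proof -
    have "(\<Prod>i=0..<k. real n - real i) / real n ^ k = (\<Prod>i=0..<k. (real n - real i) / real n)"
      by (simp add: prod_dividef)
    also have "\<dots> = (\<Prod>i=0..<k. 1 - real i / real n)"
      using that by (intro prod.cong) (auto simp: field_simps)
    finally show ?thesis
      by (simp add: binomial_gbinomial gbinomial_prod_rev poly_prod field_simps)
  qed
qed

text \<open>In the binomial expansion the terms with \<open>k > card L\<close> vanish. Each
  remaining term, divided by the power of \<open>n\<close>, is a polynomial in \<open>1 / n\<close>
  with a factor of degree \<open>card L - k\<close>. Only \<open>k = card L\<close> therefore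
  reaches the constant term, and there all blocks are singletons.\<close>

lemma conv_power_div_power_poly:
  assumes "finite L" "\<nu> {} = 1"
  obtains p :: "real poly"
  where "poly p 0 = (\<Prod>l\<in>L. \<nu> {l})"
    "\<And>n. n \<ge> 1 \<Longrightarrow> conv_power \<nu> n L / real n ^ card L = poly p (1 / real n)"
proof -
  define d c where "d = card L" and "c = (\<lambda>k. conv_power (\<nu>({} := 0)) k L)"
  have "\<forall>k. \<exists>p::real poly. poly p 0 = 1 / fact k \<and>
      (\<forall>n\<ge>1. real (n choose k) / real n ^ k = poly p (1 / real n))"
    by (metis binomial_div_power_poly)
  then obtain q :: "nat \<Rightarrow> real poly" where q0: "poly (q k) 0 = 1 / fact k"
    and q: "n \<ge> 1 \<Longrightarrow> real (n choose k) / real n ^ k = poly (q k) (1 / real n)" for k n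
    by metis
  have c0: "c k = 0" if "k > d" for k
    using that assms unfolding c_def d_def by (intro conv_power_eq_0) auto
  have cd: "c d = fact d * (\<Prod>l\<in>L. \<nu> {l})"
    unfolding c_def d_def using assms by (subst conv_power_card) auto
  show ?thesis
  proof
    let ?p = "\<Sum>k\<le>d. smult (c k) (monom 1 (d - k) * q k)"
    have "poly ?p 0 = (\<Sum>k\<le>d. c k * 0 ^ (d - k) / fact k)"
      by (simp add: poly_sum poly_monom q0)
    also have "\<dots> = (\<Sum>k\<le>d. if k = d then c d / fact d else 0)"
      by (intro sum.cong) (auto simp: power_0_left)
    finally have "poly ?p 0 = (\<Sum>k\<le>d. if k = d then c d / fact d else 0)" .
    then show "poly ?p 0 = (\<Prod>l\<in>L. \<nu> {l})" by (simp add: cd)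
    fix n :: nat assume n: "n \<ge> 1"
    have "conv_power \<nu> n L = (\<Sum>k\<le>n. real (n choose k) * c k)"
      unfolding c_def using assms by (rule conv_power_binomial)
    \<comment> \<open>The summation bound changes from \<open>n\<close> to \<open>d\<close>:
      binomial coefficients vanish above \<open>n\<close>, the numbers \<open>c k\<close> above
      \<open>d\<close>.\<close>
    also have "\<dots> = (\<Sum>k\<le>max n d. real (n choose k) * c k)"
      by (rule sum.mono_neutral_left) auto
    also have "\<dots> = (\<Sum>k\<le>d. real (n choose k) * c k)"
      by (rule sum.mono_neutral_right) (auto simp: c0)
    finally have "conv_power \<nu> n L / real n ^ d = (\<Sum>k\<le>d. real (n choose k) * c k / real n ^ d)"
      by (simp add: sum_divide_distrib)
    also have "\<dots> = (\<Sum>k\<le>d. c k * ((1 / real n) ^ (d - k) * poly (q k) (1 / real n)))"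
    proof (intro sum.cong refl)
      fix k assume "k \<in> {..d}"
      then have "real n ^ d = real n ^ (d - k) * real n ^ k" by (simp flip: power_add)
      then show "real (n choose k) * c k / real n ^ d
          = c k * ((1 / real n) ^ (d - k) * poly (q k) (1 / real n))"
        by (simp add: power_one_over flip: q[OF n])
    qed
    finally show "conv_power \<nu> n L / real n ^ card L = poly ?p (1 / real n)"
      by (simp add: poly_sum poly_monom d_def)
  qed
qed

text \<open>Expanding the product assigns a summand \<open>i\<close> to each \<open>l\<close>; the
  labels assigned to \<open>i\<close> form the cell \<open>B i\<close>. Summing over all assignments
  is what \<open>conv_power\<close> does.\<close>

lemma has_bochner_integral_prod_sum:
  fixes y :: "'l \<Rightarrow> nat \<Rightarrow> 'w \<Rightarrow> real"
  assumes "finite L"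
    and base: "\<And>B. (\<And>i. i \<in> {1..n} \<Longrightarrow> B i \<subseteq> L) \<Longrightarrow>
      has_bochner_integral M (\<lambda>\<omega>. \<Prod>i=1..n. \<Prod>l\<in>B i. y l i \<omega>) (\<Prod>i=1..n. \<nu> (B i))"
  shows "has_bochner_integral M (\<lambda>\<omega>. \<Prod>l\<in>L. \<Sum>i=1..n. y l i \<omega>) (conv_power \<nu> n L)"
proof -
  \<comment> \<open>Splitting the summands off one at a time turns the sums into products over the cells \<open>B i\<close>,
    so independence enters only through \<open>base\<close>.\<close>
  have "has_bochner_integral M
      (\<lambda>\<omega>. (\<Prod>l\<in>K. \<Sum>i=1..m. y l i \<omega>) * (\<Prod>i=Suc m..n. \<Prod>l\<in>B i. y l i \<omega>))
      (conv_power \<nu> m K * (\<Prod>i=Suc m..n. \<nu> (B i)))"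
    if "m \<le> n" "K \<subseteq> L" "\<And>i. i \<in> {Suc m..n} \<Longrightarrow> B i \<subseteq> L" for m K B
    using that
  proof (induction m arbitrary: K B)
    case 0
    have "finite K" using 0 assms(1) finite_subset by blast
    then show ?case
      using base[of B] 0 by (cases "K = {}") (auto simp: has_bochner_integral_zero power_0_left)
  next
    case (Suc m)
    have [simp]: "finite K" using Suc assms(1) finite_subset by blast
    have split: "(\<Prod>i=Suc m..n. h i) = h (Suc m) * (\<Prod>i=Suc (Suc m)..n. h i)" for h :: "nat \<Rightarrow> real"
      using Suc.prems by (intro prod.atLeast_Suc_atMost) auto
    \<comment> \<open>\<open>A\<close> collects the labels that select summand \<open>Suc m\<close>;
      it becomes the cell \<open>B (Suc m)\<close> in the induction hypothesis.\<close>
    have "has_bochner_integral M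
      (\<lambda>\<omega>. \<Sum>A\<in>Pow K. (\<Prod>l\<in>K - A. \<Sum>i=1..m. y l i \<omega>) *
          (\<Prod>i=Suc m..n. \<Prod>l\<in>(B(Suc m := A)) i. y l i \<omega>))
      (\<Sum>A\<in>Pow K. conv_power \<nu> m (K - A) * (\<Prod>i=Suc m..n. \<nu> ((B(Suc m := A)) i)))"
      by (intro has_bochner_integral_sum Suc.IH) (use Suc.prems in \<open>auto split: if_splits\<close>)
    moreover have "(\<Sum>A\<in>Pow K. (\<Prod>l\<in>K - A. \<Sum>i=1..m. y l i \<omega>) *
          (\<Prod>i=Suc m..n. \<Prod>l\<in>(B(Suc m := A)) i. y l i \<omega>))
        = (\<Prod>l\<in>K. \<Sum>i=1..Suc m. y l i \<omega>) * (\<Prod>i=Suc (Suc m)..n. \<Prod>l\<in>B i. y l i \<omega>)" for \<omega>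
    proof -
      have "(\<Prod>l\<in>K. \<Sum>i=1..Suc m. y l i \<omega>) = (\<Prod>l\<in>K. y l (Suc m) \<omega> + (\<Sum>i=1..m. y l i \<omega>))"
        by (simp add: add.commute)
      also have "\<dots> = (\<Sum>A\<in>Pow K. (\<Prod>l\<in>A. y l (Suc m) \<omega>) * (\<Prod>l\<in>K - A. \<Sum>i=1..m. y l i \<omega>))"
        by (rule prod_add) simp
      finally have eq: "(\<Prod>l\<in>K. \<Sum>i=1..Suc m. y l i \<omega>)
          = (\<Sum>A\<in>Pow K. (\<Prod>l\<in>A. y l (Suc m) \<omega>) * (\<Prod>l\<in>K - A. \<Sum>i=1..m. y l i \<omega>))" .
      show ?thesis
        unfolding split eq sum_distrib_right by (intro sum.cong refl) (simp add: mult_ac)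
    qed
    moreover have "(\<Sum>A\<in>Pow K. conv_power \<nu> m (K - A) * (\<Prod>i=Suc m..n. \<nu> ((B(Suc m := A)) i)))
        = conv_power \<nu> (Suc m) K * (\<Prod>i=Suc (Suc m)..n. \<nu> (B i))"
      unfolding split conv_power.simps sum_distrib_right
      by (intro sum.cong refl) (simp add: mult_ac)
    ultimately show ?case by simp
  qed
  from this[of n L] show ?thesis by simp
qed

text \<open>Factors that share a vector \<open>x s i\<close> may be dependent, but their product is
  a function of that vector alone, and distinct vectors are independent. That \<open>m\<close> does
  not depend on \<open>s\<close> or \<open>i\<close> expresses identical distribution.\<close>

lemma (in prob_space) has_bochner_integral_prod_indep:
  fixes \<phi> :: "'l \<Rightarrow> 'x \<Rightarrow> real" and x :: "'s \<Rightarrow> nat \<Rightarrow> 'a \<Rightarrow> 'x"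
  assumes "finite T" "finite L" "\<tau> ` L \<subseteq> T"
    and indep: "indep_vars (\<lambda>_. N) (\<lambda>(s, i). x s i) (T \<times> {1..n})"
    and meas: "\<And>l. \<phi> l \<in> borel_measurable N"
    and mom: "\<And>s i B. i \<in> {1..n} \<Longrightarrow> B \<subseteq> L \<Longrightarrow>
      has_bochner_integral M (\<lambda>\<omega>. \<Prod>l\<in>B. \<phi> l (x s i \<omega>)) (m B)"
    and B: "\<And>i. i \<in> {1..n} \<Longrightarrow> B i \<subseteq> L"
  shows "has_bochner_integral M (\<lambda>\<omega>. \<Prod>i=1..n. \<Prod>l\<in>B i. \<phi> l (x (\<tau> l) i \<omega>))
    (\<Prod>i=1..n. \<Prod>s\<in>T. m {l \<in> B i. \<tau> l = s})"
proof -
  define Y where "Y = (\<lambda>(s, i) \<omega>. \<Prod>l\<in>{l \<in> B i. \<tau> l = s}. \<phi> l (x s i \<omega>))"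
  have Y: "has_bochner_integral M (Y (s, i)) (m {l \<in> B i. \<tau> l = s})" if "i \<in> {1..n}" for s i
    unfolding Y_def prod.case using that B by (intro mom) auto
  have "indep_vars (\<lambda>_. borel)
      (\<lambda>a \<omega>. \<Prod>l\<in>{l \<in> B (snd a). \<tau> l = fst a}. \<phi> l ((\<lambda>(s, i). x s i) a \<omega>)) (T \<times> {1..n})"
    by (rule indep_vars_compose2[OF indep]) (intro borel_measurable_prod meas)
  then have indY: "indep_vars (\<lambda>_. borel) Y (T \<times> {1..n})"
    by (rule indep_vars_cong[THEN iffD1, rotated -1]) (auto simp: Y_def)
  have intY: "integrable M (Y a)" if "a \<in> T \<times> {1..n}" for a
    using Y that by (cases a) (auto simp: has_bochner_integral_iff)
  have "has_bochner_integral M (\<lambda>\<omega>. \<Prod>a\<in>T \<times> {1..n}. Y a \<omega>)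
      (\<Prod>a\<in>T \<times> {1..n}. expectation (Y a))"
    unfolding has_bochner_integral_iff using assms(1) indY intY
    by (auto intro!: indep_vars_integrable indep_vars_lebesgue_integral)
  also have "(\<lambda>\<omega>. \<Prod>a\<in>T \<times> {1..n}. Y a \<omega>) = (\<lambda>\<omega>. \<Prod>i=1..n. \<Prod>l\<in>B i. \<phi> l (x (\<tau> l) i \<omega>))"
  proof
    fix \<omega>
    have "(\<Prod>l\<in>B i. \<phi> l (x (\<tau> l) i \<omega>)) = (\<Prod>s\<in>T. Y (s, i) \<omega>)" if "i \<in> {1..n}" for i
    proof -
      have "finite (B i)" using B[OF that] assms(2) finite_subset by blast
      moreover have "\<tau> ` B i \<subseteq> T" using B[OF that] assms(3) by blast
      ultimately have "(\<Prod>l\<in>B i. \<phi> l (x (\<tau> l) i \<omega>))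
          = (\<Prod>s\<in>T. \<Prod>l\<in>{l \<in> B i. \<tau> l = s}. \<phi> l (x (\<tau> l) i \<omega>))"
        using assms(1) by (intro prod.group[symmetric])
      then show ?thesis by (simp add: Y_def)
    qed
    then have "(\<Prod>i=1..n. \<Prod>l\<in>B i. \<phi> l (x (\<tau> l) i \<omega>)) = (\<Prod>i=1..n. \<Prod>s\<in>T. Y (s, i) \<omega>)"
      by simp
    also have "\<dots> = (\<Prod>a\<in>T \<times> {1..n}. Y a \<omega>)"
      by (subst prod.swap) (simp add: prod.cartesian_product)
    finally show "(\<Prod>a\<in>T \<times> {1..n}. Y a \<omega>) = (\<Prod>i=1..n. \<Prod>l\<in>B i. \<phi> l (x (\<tau> l) i \<omega>))" ..
  qed
  also have "(\<Prod>a\<in>T \<times> {1..n}. expectation (Y a)) = (\<Prod>i=1..n. \<Prod>s\<in>T. m {l \<in> B i. \<tau> l = s})"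
  proof -
    have "(\<Prod>a\<in>T \<times> {1..n}. expectation (Y a)) = (\<Prod>i=1..n. \<Prod>s\<in>T. expectation (Y (s, i)))"
      by (subst prod.swap) (simp add: prod.cartesian_product)
    also have "\<dots> = (\<Prod>i=1..n. \<Prod>s\<in>T. m {l \<in> B i. \<tau> l = s})"
      using Y by (intro prod.cong refl) (auto simp: has_bochner_integral_iff)
    finally show ?thesis .
  qed
  finally show ?thesis .
qed

section \<open>Gaussian moments\<close>

text \<open>\<open>e k\<close> counts the occurrences of coordinate \<open>k\<close> among all
  \<open>J l\<close> and \<open>K l\<close>. In this form the Gaussian integrand factors over
  coordinates.\<close>

lemma prod_coordinates_eq_monomial:
  fixes J K :: "'l \<Rightarrow> 'n::finite"
  assumes "finite B"
  obtains e :: "'n \<Rightarrow> nat"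
  where "\<And>x :: real^'n. (\<Prod>l\<in>B. x $ J l * x $ K l) = (\<Prod>k\<in>UNIV. (x $ k) ^ e k)"
proof -
  have "\<exists>e. \<forall>x :: real^'n. (\<Prod>l\<in>B. x $ J l * x $ K l) = (\<Prod>k\<in>UNIV. (x $ k) ^ e k)"
    using assms
  proof induction
    case empty
    show ?case by (rule exI[of _ "\<lambda>_. 0"]) simp
  next
    case (insert l B)
    then obtain e where e: "\<And>x :: real^'n. (\<Prod>l\<in>B. x $ J l * x $ K l) = (\<Prod>k\<in>UNIV. (x $ k) ^ e k)"
      by blast
    have single: "x $ j = (\<Prod>k\<in>UNIV. (x $ k) ^ (if k = j then 1 else 0))" for x :: "real^'n" and j
      by (subst prod.remove[of _ j]) auto
    have "(\<Prod>k\<in>UNIV. (x $ k) ^ ((if k = J l then 1 else 0) + (if k = K l then 1 else 0) + e k))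
        = x $ J l * x $ K l * (\<Prod>k\<in>UNIV. (x $ k) ^ e k)" for x :: "real^'n"
      by (simp only: power_add prod.distrib flip: single)
    then have "(\<Prod>l\<in>insert l B. x $ J l * x $ K l)
        = (\<Prod>k\<in>UNIV. (x $ k) ^ ((if k = J l then 1 else 0) + (if k = K l then 1 else 0) + e k))"
      for x :: "real^'n"
      by (simp only: prod.insert[OF insert.hyps(1,2)] e)
    then show ?case by (intro exI allI)
  qed
  then show ?thesis using that by blast
qed

text \<open>Lebesgue measure on the space is the image of a product of one-dimensional Lebesgue
  measures, on which a product of integrable functions is integrable.\<close>

lemma integrable_lborel_prod_cart:
  fixes f :: "'n::finite \<Rightarrow> real \<Rightarrow> real"
  assumes "\<And>k. integrable lborel (f k)"
  shows "integrable lborel (\<lambda>x::real^'n. \<Prod>k\<in>UNIV. f k (x $ k))"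
proof -
  interpret product_sigma_finite "\<lambda>_::real^'n. lborel :: real measure" ..
  \<comment> \<open>The product measure is indexed by basis vectors, so the family \<open>f\<close>
    is reindexed along \<open>axis k 1\<close>.\<close>
  define g where "g = (\<lambda>b::real^'n. f (THE k. b = axis k 1))"
  have g: "g (axis k 1) = f k" for k
    by (simp add: g_def axis_eq_axis)
  have eq: "(\<Prod>k\<in>UNIV. f k (x $ k)) = (\<Prod>b\<in>Basis. g b (x \<bullet> b))" for x :: "real^'n"
  proof -
    have Basis: "(Basis :: (real^'n) set) = range (\<lambda>k. axis k 1)" by (auto simp: Basis_vec_def)
    have "inj (\<lambda>k::'n. axis k (1::real))" by (auto simp: inj_def axis_eq_axis)
    then show ?thesis unfolding Basis by (simp add: prod.reindex g inner_axis)
  qed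
  have [measurable]: "f k \<in> borel_measurable borel" for k
    using borel_measurable_integrable[OF assms] by simp
  have [measurable]: "g b \<in> borel_measurable borel" for b
    unfolding g_def by simp
  have "integrable (\<Pi>\<^sub>M b\<in>Basis. lborel) (\<lambda>y. \<Prod>b\<in>Basis. g b (y b))"
    by (intro product_integrable_prod) (auto simp: g_def assms)
  also have "(\<lambda>y. \<Prod>b\<in>Basis. g b (y b))
      = (\<lambda>y. \<Prod>b\<in>Basis. g b ((\<Sum>b\<in>Basis. y b *\<^sub>R b :: real^'n) \<bullet> b))"
    by (intro ext prod.cong) auto
  finally show ?thesis
    unfolding eq by (subst lborel_eq, subst integrable_distr_eq) auto
qed

lemma std_gaussian_density_nonneg: "std_gaussian_density x \<ge> 0"
  unfolding std_gaussian_density_def by (intro prod_nonneg) simp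

lemma integrable_std_gaussian_monomial:
  "integrable lborel (\<lambda>x::real^'n. std_gaussian_density x * (\<Prod>k\<in>UNIV. (x $ k) ^ e k))"
  unfolding std_gaussian_density_def prod.distrib[symmetric]
  by (intro integrable_lborel_prod_cart integrable_std_normal_moment)

text \<open>The expectation under N(0, I), stated without a random variable so that one value serves
  all samples and all batch sizes.\<close>

definition gaussian_integral :: "(real^'n \<Rightarrow> real) \<Rightarrow> real" where
  "gaussian_integral f = (\<integral>x. std_gaussian_density x * f x \<partial>lborel)"

lemma has_bochner_integral_std_gaussian_monomial:
  fixes X :: "'w \<Rightarrow> real^'n"
  assumes "distributed M lborel X (\<lambda>x. ennreal (std_gaussian_density x))" "finite B"
  shows "has_bochner_integral M (\<lambda>\<omega>. \<Prod>l\<in>B. X \<omega> $ J l * X \<omega> $ K l)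
    (gaussian_integral (\<lambda>x. \<Prod>l\<in>B. x $ J l * x $ K l))"
proof -
  obtain e :: "'n \<Rightarrow> nat"
    where e: "\<And>x :: real^'n. (\<Prod>l\<in>B. x $ J l * x $ K l) = (\<Prod>k\<in>UNIV. (x $ k) ^ e k)"
    using prod_coordinates_eq_monomial[OF assms(2)] by blast
  have meas: "(\<lambda>x::real^'n. \<Prod>k\<in>UNIV. (x $ k) ^ e k) \<in> borel_measurable lborel"
    by measurable
  show ?thesis
    unfolding has_bochner_integral_iff gaussian_integral_def e
    using distributed_integrable[OF assms(1) meas std_gaussian_density_nonneg]
      distributed_integral[OF assms(1) meas std_gaussian_density_nonneg]
      integrable_std_gaussian_monomial[of e] by simp
qed

text \<open>The density has total mass 1 because some random vector on a probability space has
  it.\<close>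

lemma (in prob_space) gaussian_integral_const:
  fixes X :: "'a \<Rightarrow> real^'n"
  assumes "distributed M lborel X (\<lambda>x. ennreal (std_gaussian_density x))"
  shows "gaussian_integral (\<lambda>_::real^'n. c) = c"
  unfolding gaussian_integral_def
  by (subst distributed_integral[OF assms]) (auto simp: std_gaussian_density_nonneg prob_space)

section \<open>Eventual monotonicity\<close>

text \<open>A nonzero derivative has no roots just to the right of 0, hence constant sign there.
  Starting from 0 and staying nonnegative forces that sign to be positive, and \<open>1 / n\<close>
  decreases in \<open>n\<close>.\<close>

lemma eventually_antimono_poly_inverse:
  fixes p :: "real poly"
  assumes "poly p 0 = 0" "\<And>n::nat. n \<ge> 1 \<Longrightarrow> poly p (1 / real n) \<ge> 0"
  obtains n0 :: nat where "n0 \<ge> 1" "antimono_on {n0..} (\<lambda>n. poly p (1 / real n))"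
proof (cases "pderiv p = 0")
  case True
  then have "degree p = 0" by (simp add: pderiv_eq_0_iff)
  then obtain c where "p = [:c:]" using degree_eq_zeroE by blast
  then show ?thesis by (intro that[of 1]) (auto simp: monotone_on_def)
next
  case False
  then have "finite {x. poly (pderiv p) x = 0}" by (rule poly_roots_finite)
  \<comment> \<open>A root at 0 itself does no harm: only the open interval from 0 to
    \<open>d\<close> matters.\<close>
  from finite_set_avoid[OF this, of 0] obtain d where "d > 0"
    and d: "\<And>x. poly (pderiv p) x = 0 \<Longrightarrow> x \<noteq> 0 \<Longrightarrow> d \<le> \<bar>x\<bar>"
    by (auto simp: dist_real_def)
  obtain n0 :: nat where n0: "n0 \<noteq> 0" "1 / real n0 < d"
    using reals_Archimedean[OF \<open>d > 0\<close>] by (metis inverse_eq_divide nat.simps(3))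
  have "0 < 1 / real n0" using n0 by simp
  \<comment> \<open>Between 0 and \<open>1 / n0\<close> the polynomial goes from 0 to a nonnegative
    value, which yields one point \<open>y\<close> that fixes the sign.\<close>
  from poly_MVT[OF this, of p] obtain y where y: "0 < y" "y < 1 / real n0"
    and "poly p (1 / real n0) = 1 / real n0 * poly (pderiv p) y"
    using assms(1) by auto
  then have "poly (pderiv p) y \<ge> 0" using assms(2)[of n0] n0
    by (auto simp: zero_le_mult_iff zero_le_divide_iff)
  moreover have "poly (pderiv p) y \<noteq> 0" using d[of y] y n0 by auto
  ultimately have y_pos: "poly (pderiv p) y > 0" by simp
  have pos: "poly (pderiv p) x > 0" if x: "0 < x" "x < d" for x
  proof (rule ccontr)
    assume "\<not> poly (pderiv p) x > 0"
    with d[of x] x have neg: "poly (pderiv p) x < 0" by (cases "poly (pderiv p) x = 0") auto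
    then have prod: "poly (pderiv p) x * poly (pderiv p) y < 0"
        "poly (pderiv p) y * poly (pderiv p) x < 0"
      using y_pos by (auto intro: mult_neg_pos mult_pos_neg)
    have "x \<noteq> y" using neg y_pos by auto
    then consider "x < y" | "y < x" by linarith
    then obtain z where "poly (pderiv p) z = 0" "0 < z" "z < d"
    proof cases
      case 1
      from poly_IVT[OF 1 prod(1)] show ?thesis using that x y n0 by force
    next
      case 2
      from poly_IVT[OF 2 prod(2)] show ?thesis using that x y n0 by force
    qed
    with d[of z] show False by auto
  qed
  have "poly p (1 / real n) \<le> poly p (1 / real m)" if "n0 \<le> m" "m < n" for m n
  proof -
    have lt: "1 / real n < 1 / real m" using that n0 by (simp add: frac_less2)
    have "1 / real m \<le> 1 / real n0" using that n0 by (intro divide_left_mono) auto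
    then have m: "1 / real m < d" using n0 by linarith
    have n: "1 / real n > 0" using that by simp
    from poly_MVT[OF lt, of p] obtain x where x: "1 / real n < x" "x < 1 / real m"
      "poly p (1 / real m) - poly p (1 / real n) = (1 / real m - 1 / real n) * poly (pderiv p) x"
      by blast
    then have "poly (pderiv p) x > 0" using pos[of x] m n by linarith
    then have "poly p (1 / real m) - poly p (1 / real n) > 0"
      unfolding x(3) using lt by simp
    then show ?thesis by simp
  qed
  then show ?thesis
    by (intro that[of n0]) (use n0 in \<open>auto simp: monotone_on_def le_less\<close>)
qed

section \<open>Polynomial expressions in the empirical second moments\<close>

text \<open>\<open>X b s i\<close> is sample \<open>i\<close> of iteration \<open>s\<close> in the
  run with batch size \<open>b\<close>. Moments are only ever taken within one run, so runs with
  different \<open>b\<close> may have any joint law.\<close>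

locale minibatch_samples = prob_space M for M :: "'w measure" +
  fixes X :: "nat \<Rightarrow> nat \<Rightarrow> nat \<Rightarrow> 'w \<Rightarrow> real^'p"
  assumes distributed_X: "b \<ge> 1 \<Longrightarrow> i \<in> {1..b} \<Longrightarrow>
      distributed M lborel (X b s i) (\<lambda>x. ennreal (std_gaussian_density x))"
    and indep_X: "b \<ge> 1 \<Longrightarrow> indep_vars (\<lambda>_. borel) (\<lambda>(s, i). X b s i) (UNIV \<times> {1..b})"
begin

text \<open>A triple names an iteration and a matrix entry, so a monomial is a list of
  triples.\<close>

definition empirical_moment :: "nat \<Rightarrow> nat \<times> 'p \<times> 'p \<Rightarrow> 'w \<Rightarrow> real" where
  "empirical_moment b a \<omega> =
     (case a of (s, j, k) \<Rightarrow> (\<Sum>i=1..b. X b s i \<omega> $ j * X b s i \<omega> $ k) / real b)"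

definition population_moment :: "nat \<times> 'p \<times> 'p \<Rightarrow> real" where
  "population_moment a = (case a of (s, j, k) \<Rightarrow> gaussian_integral (\<lambda>x::real^'p. x $ j * x $ k))"

text \<open>A single polynomial serves all \<open>b\<close>. Its constant term \<open>y\<close>, the
  limit of the expectations, is recorded because the constant terms have to cancel in the
  variance.\<close>

definition poly_mean :: "(nat \<Rightarrow> 'w \<Rightarrow> real) \<Rightarrow> real \<Rightarrow> bool" where
  "poly_mean Y y \<longleftrightarrow> (\<exists>p. poly p 0 = y \<and>
     (\<forall>b\<ge>1. has_bochner_integral M (Y b) (poly p (1 / real b))))"

lemma poly_mean_add:
  assumes "poly_mean Y y" "poly_mean Z z"
  shows "poly_mean (\<lambda>b \<omega>. Y b \<omega> + Z b \<omega>) (y + z)"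
proof -
  obtain p q where "poly p 0 = y" "poly q 0 = z"
    "\<And>b. b \<ge> 1 \<Longrightarrow> has_bochner_integral M (Y b) (poly p (1 / real b))"
    "\<And>b. b \<ge> 1 \<Longrightarrow> has_bochner_integral M (Z b) (poly q (1 / real b))"
    using assms unfolding poly_mean_def by blast
  then show ?thesis
    unfolding poly_mean_def by (intro exI[of _ "p + q"]) auto
qed

lemma poly_mean_cmult:
  assumes "poly_mean Y y"
  shows "poly_mean (\<lambda>b \<omega>. c * Y b \<omega>) (c * y)"
proof -
  obtain p where "poly p 0 = y"
    "\<And>b. b \<ge> 1 \<Longrightarrow> has_bochner_integral M (Y b) (poly p (1 / real b))"
    using assms unfolding poly_mean_def by blast
  then show ?thesis
    unfolding poly_mean_def by (intro exI[of _ "smult c p"]) auto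
qed

text \<open>Up to the power of \<open>b\<close>, the product of sums has expectation
  \<open>conv_power \<nu> b L\<close>; the singleton values of \<open>\<nu>\<close> are the
  population moments.\<close>

lemma poly_mean_prod_list_empirical_moment:
  "poly_mean (\<lambda>b \<omega>. prod_list (map (\<lambda>a. empirical_moment b a \<omega>) ls))
     (prod_list (map population_moment ls))"
proof -
  \<comment> \<open>Labels are list positions, so repeated triples stay distinct.\<close>
  define L \<tau> J K T where "L = {0..<length ls}" and "\<tau> = (\<lambda>l. fst (ls ! l))"
    and "J = (\<lambda>l. fst (snd (ls ! l)))" and "K = (\<lambda>l. snd (snd (ls ! l)))" and "T = \<tau> ` L"
  define m where "m = (\<lambda>B. gaussian_integral (\<lambda>x::real^'p. \<Prod>l\<in>B. x $ J l * x $ K l))"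
  \<comment> \<open>\<open>\<nu> B\<close> is the moment of the \<open>i\<close>-th samples of all
    iterations together; by independence it factors over the iterations.\<close>
  define \<nu> where "\<nu> = (\<lambda>B. \<Prod>s\<in>T. m {l \<in> B. \<tau> l = s})"
  have fin: "finite L" "finite T" by (auto simp: L_def T_def)
  have "m {} = 1"
    unfolding m_def using gaussian_integral_const[OF distributed_X[of 1 1]] by simp
  then have \<nu>: "\<nu> {} = 1" by (simp add: \<nu>_def)
  have \<nu>1: "\<nu> {l} = population_moment (ls ! l)" if "l \<in> L" for l
  proof -
    have "\<nu> {l} = (\<Prod>s\<in>T. if s = \<tau> l then m {l} else 1)"
      unfolding \<nu>_def
    proof (intro prod.cong refl)
      fix s
      have "{l' \<in> {l}. \<tau> l' = s} = (if s = \<tau> l then {l} else {})" by auto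
      then show "m {l' \<in> {l}. \<tau> l' = s} = (if s = \<tau> l then m {l} else 1)"
        using \<open>m {} = 1\<close> by simp
    qed
    also have "\<dots> = m {l}" using that fin by (simp add: T_def)
    finally show ?thesis
      by (simp add: m_def population_moment_def J_def K_def split: prod.split)
  qed
  obtain p where p0: "poly p 0 = (\<Prod>l\<in>L. \<nu> {l})"
    and p: "\<And>b. b \<ge> 1 \<Longrightarrow> conv_power \<nu> b L / real b ^ card L = poly p (1 / real b)"
    using conv_power_div_power_poly[of L \<nu>] fin \<nu> by blast
  have "has_bochner_integral M (\<lambda>\<omega>. prod_list (map (\<lambda>a. empirical_moment b a \<omega>) ls))
      (poly p (1 / real b))" if b: "b \<ge> 1" for b
  proof -
    have "has_bochner_integral M
        (\<lambda>\<omega>. \<Prod>l\<in>L. \<Sum>i=1..b. X b (\<tau> l) i \<omega> $ J l * X b (\<tau> l) i \<omega> $ K l) (conv_power \<nu> b L)"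
    proof (rule has_bochner_integral_prod_sum[OF fin(1)])
      fix B :: "nat \<Rightarrow> nat set" assume B: "\<And>i. i \<in> {1..b} \<Longrightarrow> B i \<subseteq> L"
      show "has_bochner_integral M
          (\<lambda>\<omega>. \<Prod>i=1..b. \<Prod>l\<in>B i. X b (\<tau> l) i \<omega> $ J l * X b (\<tau> l) i \<omega> $ K l) (\<Prod>i=1..b. \<nu> (B i))"
        unfolding \<nu>_def
      proof (rule has_bochner_integral_prod_indep[OF fin(2) fin(1), where N = borel
            and \<phi> = "\<lambda>l x. x $ J l * x $ K l"])
        show "indep_vars (\<lambda>_. borel) (\<lambda>(s, i). X b s i) (T \<times> {1..b})"
          by (rule indep_vars_subset[OF indep_X[OF b]]) auto
        show "has_bochner_integral M (\<lambda>\<omega>. \<Prod>l\<in>A. X b s i \<omega> $ J l * X b s i \<omega> $ K l) (m A)"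
          if "i \<in> {1..b}" "A \<subseteq> L" for s i A
          unfolding m_def using that fin b
          by (intro has_bochner_integral_std_gaussian_monomial distributed_X)
            (auto intro: finite_subset)
      qed (use B in \<open>auto simp: T_def\<close>)
    qed
    then have "has_bochner_integral M
        (\<lambda>\<omega>. (\<Prod>l\<in>L. \<Sum>i=1..b. X b (\<tau> l) i \<omega> $ J l * X b (\<tau> l) i \<omega> $ K l) / real b ^ card L)
        (conv_power \<nu> b L / real b ^ card L)"
      by (rule has_bochner_integral_divide_zero)
    also have "(\<lambda>\<omega>. (\<Prod>l\<in>L. \<Sum>i=1..b. X b (\<tau> l) i \<omega> $ J l * X b (\<tau> l) i \<omega> $ K l) / real b ^ card L)
        = (\<lambda>\<omega>. prod_list (map (\<lambda>a. empirical_moment b a \<omega>) ls))"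
      by (simp add: prod.list_conv_set_nth empirical_moment_def case_prod_unfold L_def \<tau>_def J_def
          K_def prod_dividef)
    finally show ?thesis using p[OF b] by simp
  qed
  moreover have "poly p 0 = prod_list (map population_moment ls)"
    using p0 \<nu>1 by (simp add: prod.list_conv_set_nth L_def)
  ultimately show ?thesis unfolding poly_mean_def by blast
qed

text \<open>To make \<open>poly_mean\<close> stable under products, it is first required for all products with monomials
  in the empirical moments, and then \<open>has_limit\<close> asks a factor to preserve this property.\<close>

definition stably_poly_mean :: "(nat \<Rightarrow> 'w \<Rightarrow> real) \<Rightarrow> real \<Rightarrow> bool" where
  "stably_poly_mean Y y \<longleftrightarrow> (\<forall>ls. poly_mean
     (\<lambda>b \<omega>. Y b \<omega> * prod_list (map (\<lambda>a. empirical_moment b a \<omega>) ls))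
     (y * prod_list (map population_moment ls)))"

definition has_limit :: "(nat \<Rightarrow> 'w \<Rightarrow> real) \<Rightarrow> real \<Rightarrow> bool" where
  "has_limit Z z \<longleftrightarrow>
     (\<forall>Y y. stably_poly_mean Y y \<longrightarrow> stably_poly_mean (\<lambda>b \<omega>. Z b \<omega> * Y b \<omega>) (z * y))"

text \<open>The constant 1 is stable by the monomial case; the factor acts on it, and the empty
  monomial is then chosen.\<close>

lemma has_limit_imp_poly_mean:
  assumes "has_limit Z z"
  shows "poly_mean Z z"
proof -
  have "stably_poly_mean (\<lambda>_ _. 1) 1"
    using poly_mean_prod_list_empirical_moment by (simp add: stably_poly_mean_def)
  with assms have "stably_poly_mean (\<lambda>b \<omega>. Z b \<omega> * 1) (z * 1)"
    unfolding has_limit_def by blast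
  then show ?thesis
    unfolding stably_poly_mean_def by (elim allE[of _ "[]"]) simp
qed

lemma has_limit_const: "has_limit (\<lambda>_ _. c) c"
  unfolding has_limit_def stably_poly_mean_def
  by (auto simp: mult.assoc intro: poly_mean_cmult)

text \<open>One more moment only lengthens the monomial by one entry.\<close>

lemma has_limit_empirical_moment:
  "has_limit (\<lambda>b. empirical_moment b a) (population_moment a)"
  unfolding has_limit_def
proof (intro allI impI)
  fix Y y assume Y: "stably_poly_mean Y y"
  show "stably_poly_mean (\<lambda>b \<omega>. empirical_moment b a \<omega> * Y b \<omega>) (population_moment a * y)"
    unfolding stably_poly_mean_def
  proof
    fix ls
    from Y show "poly_mean
        (\<lambda>b \<omega>. empirical_moment b a \<omega> * Y b \<omega> * prod_list (map (\<lambda>a. empirical_moment b a \<omega>) ls))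
        (population_moment a * y * prod_list (map population_moment ls))"
      unfolding stably_poly_mean_def by (elim allE[of _ "a # ls"]) (simp add: mult_ac)
  qed
qed

lemma has_limit_add:
  assumes "has_limit Y y" "has_limit Z z"
  shows "has_limit (\<lambda>b \<omega>. Y b \<omega> + Z b \<omega>) (y + z)"
  using assms unfolding has_limit_def stably_poly_mean_def
  by (auto simp: distrib_right intro: poly_mean_add)

text \<open>Two multiplications that each preserve \<open>stably_poly_mean\<close> do so in
  succession.\<close>

lemma has_limit_mult:
  assumes "has_limit Y y" "has_limit Z z"
  shows "has_limit (\<lambda>b \<omega>. Y b \<omega> * Z b \<omega>) (y * z)"
  using assms unfolding has_limit_def by (simp add: mult.assoc)

lemma has_limit_sum:
  assumes "\<And>k. k \<in> A \<Longrightarrow> has_limit (Z k) (z k)"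
  shows "has_limit (\<lambda>b \<omega>. \<Sum>k\<in>A. Z k b \<omega>) (\<Sum>k\<in>A. z k)"
  using assms by (induction A rule: infinite_finite_induct)
    (auto intro: has_limit_add has_limit_const)

text \<open>The limit is left existential because the constant term of the variance cancels whatever
  its value.\<close>

definition convergent_matrix :: "(nat \<Rightarrow> 'w \<Rightarrow> real^'n^'m) \<Rightarrow> bool" where
  "convergent_matrix Z \<longleftrightarrow> (\<exists>A. \<forall>i j. has_limit (\<lambda>b \<omega>. Z b \<omega> $ i $ j) (A $ i $ j))"

lemma convergent_matrixI:
  assumes "\<And>i j. has_limit (\<lambda>b \<omega>. Z b \<omega> $ i $ j) (a i j)"
  shows "convergent_matrix Z"
  unfolding convergent_matrix_def using assms by (intro exI[of _ "\<chi> i j. a i j"]) simp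

lemma convergent_matrixE:
  assumes "convergent_matrix Z"
  obtains A where "\<And>i j. has_limit (\<lambda>b \<omega>. Z b \<omega> $ i $ j) (A $ i $ j)"
  using assms unfolding convergent_matrix_def by blast

lemma convergent_matrix_const: "convergent_matrix (\<lambda>_ _. A)"
  by (rule convergent_matrixI, rule has_limit_const)

text \<open>The scalar is the same for all \<open>b\<close>; this is where learning rates
  independent of the batch size enter.\<close>

lemma convergent_matrix_diff_scaleR:
  assumes "convergent_matrix Y" "convergent_matrix Z"
  shows "convergent_matrix (\<lambda>b \<omega>. Y b \<omega> - c *\<^sub>R Z b \<omega>)"
proof -
  obtain A B where A: "\<And>i j. has_limit (\<lambda>b \<omega>. Y b \<omega> $ i $ j) (A $ i $ j)"
    and B: "\<And>i j. has_limit (\<lambda>b \<omega>. Z b \<omega> $ i $ j) (B $ i $ j)"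
    using assms by (auto elim!: convergent_matrixE)
  have "has_limit (\<lambda>b \<omega>. Y b \<omega> $ i $ j + (- c) * Z b \<omega> $ i $ j) (A $ i $ j + (- c) * B $ i $ j)" for i j
    by (intro has_limit_add has_limit_mult has_limit_const A B)
  then show ?thesis by (intro convergent_matrixI) simp
qed

lemma convergent_matrix_mult:
  assumes "convergent_matrix Y" "convergent_matrix Z"
  shows "convergent_matrix (\<lambda>b \<omega>. Y b \<omega> ** Z b \<omega>)"
proof -
  obtain A B where A: "\<And>i j. has_limit (\<lambda>b \<omega>. Y b \<omega> $ i $ j) (A $ i $ j)"
    and B: "\<And>i j. has_limit (\<lambda>b \<omega>. Z b \<omega> $ i $ j) (B $ i $ j)"
    using assms by (auto elim!: convergent_matrixE)
  have "has_limit (\<lambda>b \<omega>. \<Sum>k\<in>UNIV. Y b \<omega> $ i $ k * Z b \<omega> $ k $ j)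
      (\<Sum>k\<in>UNIV. A $ i $ k * B $ k $ j)" for i j
    by (intro has_limit_sum has_limit_mult A B)
  then show ?thesis
    by (intro convergent_matrixI) (simp add: matrix_matrix_mult_def)
qed

lemma convergent_matrix_transpose:
  assumes "convergent_matrix Z"
  shows "convergent_matrix (\<lambda>b \<omega>. transpose (Z b \<omega>))"
proof -
  obtain A where "\<And>i j. has_limit (\<lambda>b \<omega>. Z b \<omega> $ i $ j) (A $ i $ j)"
    using assms by (auto elim!: convergent_matrixE)
  then show ?thesis
    by (intro convergent_matrixI[where a = "\<lambda>i j. A $ j $ i"]) (simp add: transpose_def)
qed

end

section \<open>The gradients of SGD\<close>

lemma matrix_mult_sum_right: "A ** (\<Sum>i\<in>I. B i) = (\<Sum>i\<in>I. A ** B i)"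
  for A :: "real^'n^'m"
  by (induction I rule: infinite_finite_induct) (auto simp: matrix_add_ldistrib)

lemma matrix_mult_sum_left: "(\<Sum>i\<in>I. A i) ** B = (\<Sum>i\<in>I. A i ** B)"
  for B :: "real^'n^'m"
  by (induction I rule: infinite_finite_induct) (auto simp: matrix_matrix_mult_def vec_eq_iff distrib_right sum.distrib)

text \<open>By linearity the batch enters only through its empirical second moment matrix.\<close>

lemma batch_grad1_eq:
  "batch_grad1 V1 V2 b x W1 W2 = transpose W2 ** residual V1 V2 W1 W2 **
     ((1 / real b) *\<^sub>R (\<Sum>i=1..b. outer_product (x i) (x i)))"
  unfolding batch_grad1_def
  by (simp add: matrix_mult_sum_right matrix_scalar_ac scaleR_sum_right flip: scalar_matrix_assoc)

lemma batch_grad2_eq: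
  "batch_grad2 V1 V2 b x W1 W2 = residual V1 V2 W1 W2 **
     ((1 / real b) *\<^sub>R (\<Sum>i=1..b. outer_product (x i) (x i))) ** transpose W1"
  unfolding batch_grad2_def
  by (simp add: matrix_mult_sum_right matrix_mult_sum_left matrix_scalar_ac scaleR_sum_right flip: scalar_matrix_assoc)

section \<open>Conditioning on deterministic initial weights\<close>

lemma norm_power2_vec: "(norm x)\<^sup>2 = (\<Sum>k\<in>UNIV. (x $ k)\<^sup>2)" for x :: "real^'n"
  unfolding power2_norm_eq_inner inner_vec_def by (simp add: power2_eq_square)

text \<open>Preimages under a constant map are empty or the whole space, and on both the constant
  \<open>expectation f\<close> has the same integral as \<open>f\<close>.\<close>

lemma (in prob_space) real_cond_exp_initial_sigma_algebra:
  assumes f: "integrable M f"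
  shows "AE \<omega> in M. real_cond_exp M (initial_sigma_algebra M A1 A2) f \<omega> = expectation f"
proof -
  let ?F = "initial_sigma_algebra M A1 A2"
  have sets: "A = {} \<or> A = space M" if "A \<in> sets ?F" for A
    using that unfolding initial_sigma_algebra_def by (auto simp: sets_vimage_algebra2 split: if_splits)
  interpret finite_measure_subalgebra M ?F
    by unfold_locales (auto simp: subalgebra_def initial_sigma_algebra_def dest!: sets[unfolded initial_sigma_algebra_def])
  show ?thesis
  proof (rule real_cond_exp_charact)
    fix A assume "A \<in> sets ?F"
    then consider "A = {}" | "A = space M" using sets by blast
    then show "(\<integral>x\<in>A. f x \<partial>M) = (\<integral>x\<in>A. expectation f \<partial>M)"
      by cases (auto simp: set_integral_space f prob_space set_lebesgue_integral_def[of M "{}"])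
  qed (use f in auto)
qed

lemma (in prob_space) mat_cond_var_initial_sigma_algebra:
  fixes Z :: "'a \<Rightarrow> real^'n^'m"
  assumes Z: "\<And>i j. integrable M (\<lambda>\<omega>. Z \<omega> $ i $ j)" "\<And>i j. integrable M (\<lambda>\<omega>. (Z \<omega> $ i $ j)\<^sup>2)"
  shows "AE \<omega> in M. mat_cond_var M (initial_sigma_algebra M A1 A2) Z \<omega>
    = (\<Sum>k\<in>UNIV. variance (\<lambda>\<omega>. Z \<omega> $ fst k $ snd k))"
proof -
  let ?F = "initial_sigma_algebra M A1 A2"
  have norm: "(norm (vectorize (Z \<omega>)))\<^sup>2 = (\<Sum>k\<in>UNIV. (Z \<omega> $ fst k $ snd k)\<^sup>2)" for \<omega>
    by (simp add: norm_power2_vec vectorize_def)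
  have "AE \<omega> in M. real_cond_exp M ?F (\<lambda>\<omega>. (norm (vectorize (Z \<omega>)))\<^sup>2) \<omega>
      = (\<Sum>k\<in>UNIV. expectation (\<lambda>\<omega>. (Z \<omega> $ fst k $ snd k)\<^sup>2))"
    using real_cond_exp_initial_sigma_algebra[of "\<lambda>\<omega>. (norm (vectorize (Z \<omega>)))\<^sup>2"] Z
    by (simp add: norm)
  moreover have "AE \<omega> in M. \<forall>k. real_cond_exp M ?F (\<lambda>\<omega>. vectorize (Z \<omega>) $ k) \<omega>
      = expectation (\<lambda>\<omega>. Z \<omega> $ fst k $ snd k)"
    by (intro eventually_all_finite) (simp add: vectorize_def real_cond_exp_initial_sigma_algebra Z)
  ultimately show ?thesis
    by eventually_elim
      (simp add: mat_cond_var_def vec_cond_exp_def norm_power2_vec variance_eq Z sum_subtractf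
        del: split_paired_All)
qed

section \<open>Monotonicity of the variance for convergent matrices\<close>

context minibatch_samples begin

lemma variance_poly:
  assumes "has_limit Z z"
  obtains p :: "real poly" where "poly p 0 = 0"
    "\<And>b. b \<ge> 1 \<Longrightarrow> integrable M (Z b)" "\<And>b. b \<ge> 1 \<Longrightarrow> integrable M (\<lambda>\<omega>. (Z b \<omega>)\<^sup>2)"
    "\<And>b. b \<ge> 1 \<Longrightarrow> variance (Z b) = poly p (1 / real b)"
proof -
  obtain p where p: "poly p 0 = z"
    "\<And>b. b \<ge> 1 \<Longrightarrow> has_bochner_integral M (Z b) (poly p (1 / real b))"
    using has_limit_imp_poly_mean[OF assms] unfolding poly_mean_def by blast
  \<comment> \<open>Closure under products gives the second moment the constant term
    \<open>z * z\<close>, which cancels against the squared mean.\<close>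
  obtain q where q: "poly q 0 = z * z"
    "\<And>b. b \<ge> 1 \<Longrightarrow> has_bochner_integral M (\<lambda>\<omega>. Z b \<omega> * Z b \<omega>) (poly q (1 / real b))"
    using has_limit_imp_poly_mean[OF has_limit_mult[OF assms assms]] unfolding poly_mean_def by blast
  show ?thesis
  proof
    show "poly (q - p\<^sup>2) 0 = 0" using p q by (simp add: power2_eq_square)
    fix b :: nat assume b: "b \<ge> 1"
    show 1: "integrable M (Z b)" and 2: "integrable M (\<lambda>\<omega>. (Z b \<omega>)\<^sup>2)"
      using p(2)[OF b] q(2)[OF b] by (auto simp: has_bochner_integral_iff power2_eq_square)
    show "variance (Z b) = poly (q - p\<^sup>2) (1 / real b)"
      unfolding variance_eq[OF 1 2] using p(2)[OF b] q(2)[OF b]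
      by (simp add: has_bochner_integral_iff power2_eq_square)
  qed
qed

lemma eventually_antimono_mat_cond_var:
  fixes Z :: "nat \<Rightarrow> 'w \<Rightarrow> real^'n^'m"
  assumes "convergent_matrix Z"
  obtains b0 where "b0 \<ge> 1"
    "AE \<omega> in M. antimono_on {b0..} (\<lambda>b. mat_cond_var M (initial_sigma_algebra M A1 A2) (Z b) \<omega>)"
proof -
  obtain A where A: "\<And>i j. has_limit (\<lambda>b \<omega>. Z b \<omega> $ i $ j) (A $ i $ j)"
    using assms by (auto elim!: convergent_matrixE)
  define Q where "Q = (\<lambda>i j (p :: real poly). poly p 0 = 0 \<and> (\<forall>b\<ge>1.
      integrable M (\<lambda>\<omega>. Z b \<omega> $ i $ j) \<and> integrable M (\<lambda>\<omega>. (Z b \<omega> $ i $ j)\<^sup>2) \<and>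
      variance (\<lambda>\<omega>. Z b \<omega> $ i $ j) = poly p (1 / real b)))"
  have "\<exists>p. Q i j p" for i j
    by (rule variance_poly[OF A[of i j]]) (auto simp: Q_def)
  then obtain p where "Q i j (p i j)" for i j by metis
  then have p0: "poly (p i j) 0 = 0"
    and p: "b \<ge> 1 \<Longrightarrow> integrable M (\<lambda>\<omega>. Z b \<omega> $ i $ j) \<and> integrable M (\<lambda>\<omega>. (Z b \<omega> $ i $ j)\<^sup>2) \<and>
      variance (\<lambda>\<omega>. Z b \<omega> $ i $ j) = poly (p i j) (1 / real b)" for i j b
    unfolding Q_def by blast+
  define P where "P = (\<Sum>k\<in>UNIV. p (fst k) (snd k))"
  have P: "(\<Sum>k\<in>UNIV. variance (\<lambda>\<omega>. Z b \<omega> $ fst k $ snd k)) = poly P (1 / real b)" if "b \<ge> 1" for b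
    using p[OF that] by (simp add: P_def poly_sum)
  have "poly P (1 / real b) \<ge> 0" if "b \<ge> 1" for b
    unfolding P[OF that, symmetric] by (intro sum_nonneg variance_positive)
  moreover have "poly P 0 = 0" by (simp add: P_def poly_sum p0)
  ultimately obtain b0 where b0: "b0 \<ge> 1" "antimono_on {b0..} (\<lambda>b. poly P (1 / real b))"
    using eventually_antimono_poly_inverse by blast
  have "AE \<omega> in M. mat_cond_var M (initial_sigma_algebra M A1 A2) (Z b) \<omega> = poly P (1 / real b)"
    if "b \<ge> 1" for b
    unfolding P[OF that, symmetric] using p[OF that] by (intro mat_cond_var_initial_sigma_algebra) auto
  \<comment> \<open>There are countably many batch sizes, so one null set serves them all.\<close>
  then have "AE \<omega> in M. \<forall>b. b \<ge> 1 \<longrightarrow>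
      mat_cond_var M (initial_sigma_algebra M A1 A2) (Z b) \<omega> = poly P (1 / real b)"
    by (simp add: AE_all_countable)
  then have "AE \<omega> in M. antimono_on {b0..} (\<lambda>b. mat_cond_var M (initial_sigma_algebra M A1 A2) (Z b) \<omega>)"
    by eventually_elim (use b0 in \<open>auto simp: monotone_on_def\<close>)
  with b0(1) show ?thesis by (rule that)
qed

section \<open>Convergence of the SGD iterates and gradients\<close>

lemma convergent_matrix_batch_second_moment:
  "convergent_matrix (\<lambda>b \<omega>. (1 / real b) *\<^sub>R (\<Sum>i=1..b. outer_product (X b s i \<omega>) (X b s i \<omega>)))"
proof (rule convergent_matrixI)
  fix i j
  show "has_limit (\<lambda>b \<omega>. ((1 / real b) *\<^sub>R
      (\<Sum>i=1..b. outer_product (X b s i \<omega>) (X b s i \<omega>))) $ i $ j) (population_moment (s, i, j))"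
    using has_limit_empirical_moment[of "(s, i, j)"]
    by (simp add: empirical_moment_def[abs_def] outer_product_def)
qed

lemma convergent_matrix_batch_grad:
  assumes "convergent_matrix W1" "convergent_matrix W2"
  shows "convergent_matrix (\<lambda>b \<omega>. batch_grad1 V1 V2 b (\<lambda>i. X b s i \<omega>) (W1 b \<omega>) (W2 b \<omega>))" (is ?g1)
    and "convergent_matrix (\<lambda>b \<omega>. batch_grad2 V1 V2 b (\<lambda>i. X b s i \<omega>) (W1 b \<omega>) (W2 b \<omega>))" (is ?g2)
proof -
  have "convergent_matrix (\<lambda>b \<omega>. W2 b \<omega> ** W1 b \<omega> - 1 *\<^sub>R (V2 ** V1))"
    by (intro convergent_matrix_diff_scaleR convergent_matrix_mult convergent_matrix_const assms)
  then have res: "convergent_matrix (\<lambda>b \<omega>. residual V1 V2 (W1 b \<omega>) (W2 b \<omega>))"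
    by (simp add: residual_def)
  show ?g1 ?g2
    unfolding batch_grad1_eq batch_grad2_eq
    by (intro convergent_matrix_mult convergent_matrix_transpose
        convergent_matrix_batch_second_moment res assms)+
qed

text \<open>Each update combines the previous weights and the new second moments by closed
  operations. The layers are treated jointly since each gradient involves both.\<close>

lemma convergent_matrix_sgd_weights:
  "convergent_matrix (\<lambda>b \<omega>. fst (sgd_weights V1 V2 A1 A2 \<alpha> b (\<lambda>s i. X b s i \<omega>) t)) \<and>
   convergent_matrix (\<lambda>b \<omega>. snd (sgd_weights V1 V2 A1 A2 \<alpha> b (\<lambda>s i. X b s i \<omega>) t))"
proof (induction t)
  case 0
  then show ?case by (simp add: convergent_matrix_const)
next
  case (Suc t)
  then show ?case
    by (auto simp: case_prod_unfold Let_def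
        intro!: convergent_matrix_diff_scaleR convergent_matrix_batch_grad)
qed

lemma convergent_matrix_sgd_grad:
  "convergent_matrix (\<lambda>b \<omega>. sgd_grad1 V1 V2 A1 A2 \<alpha> b (\<lambda>s i. X b s i \<omega>) t)"
  "convergent_matrix (\<lambda>b \<omega>. sgd_grad2 V1 V2 A1 A2 \<alpha> b (\<lambda>s i. X b s i \<omega>) t)"
  by (simp_all add: sgd_grad1_def sgd_grad2_def case_prod_unfold Let_def
      convergent_matrix_batch_grad convergent_matrix_sgd_weights)

end

theorem theorem5:
  fixes M :: "'w measure"
    and V1 :: "real^'p^'q" and V2 :: "real^'q^'o"
    and A1 :: "real^'p^'h" and A2 :: "real^'h^'o"
    and \<alpha> :: "nat \<Rightarrow> real"
    and X :: "nat \<Rightarrow> nat \<Rightarrow> nat \<Rightarrow> 'w \<Rightarrow> real^'p"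
    and t :: nat
  assumes "prob_space M"
    and "\<And>s. \<alpha> s > 0"
    and "\<And>b s i. b \<ge> 1 \<Longrightarrow> i \<in> {1..b} \<Longrightarrow>
           distributed M lborel (X b s i) (\<lambda>x. ennreal (std_gaussian_density x))"
    and "\<And>b. b \<ge> 1 \<Longrightarrow>
           prob_space.indep_vars M (\<lambda>_. borel) (\<lambda>(s, i). X b s i) (UNIV \<times> {1..b})"
  defines "F0 \<equiv> initial_sigma_algebra M A1 A2"
  shows "\<exists>b0\<ge>1. AE \<omega> in M.
           antimono_on {b0..}
             (\<lambda>b. mat_cond_var M F0 (\<lambda>\<omega>. sgd_grad1 V1 V2 A1 A2 \<alpha> b (\<lambda>s i. X b s i \<omega>) t) \<omega>) \<and>
           antimono_on {b0..}
             (\<lambda>b. mat_cond_var M F0 (\<lambda>\<omega>. sgd_grad2 V1 V2 A1 A2 \<alpha> b (\<lambda>s i. X b s i \<omega>) t) \<omega>)"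
proof -
  interpret minibatch_samples M X
    using assms(1,3,4) by (intro minibatch_samples.intro minibatch_samples_axioms.intro)
  obtain b1 where b1: "b1 \<ge> 1" "AE \<omega> in M. antimono_on {b1..}
      (\<lambda>b. mat_cond_var M F0 (\<lambda>\<omega>. sgd_grad1 V1 V2 A1 A2 \<alpha> b (\<lambda>s i. X b s i \<omega>) t) \<omega>)"
    unfolding F0_def by (rule eventually_antimono_mat_cond_var[OF convergent_matrix_sgd_grad(1)])
  obtain b2 where b2: "b2 \<ge> 1" "AE \<omega> in M. antimono_on {b2..}
      (\<lambda>b. mat_cond_var M F0 (\<lambda>\<omega>. sgd_grad2 V1 V2 A1 A2 \<alpha> b (\<lambda>s i. X b s i \<omega>) t) \<omega>)"
    unfolding F0_def by (rule eventually_antimono_mat_cond_var[OF convergent_matrix_sgd_grad(2)])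
  show ?thesis
  proof (intro exI[of _ "max b1 b2"] conjI)
    show "max b1 b2 \<ge> 1" using b1(1) by simp
    show "AE \<omega> in M.
           antimono_on {max b1 b2..}
             (\<lambda>b. mat_cond_var M F0 (\<lambda>\<omega>. sgd_grad1 V1 V2 A1 A2 \<alpha> b (\<lambda>s i. X b s i \<omega>) t) \<omega>) \<and>
           antimono_on {max b1 b2..}
             (\<lambda>b. mat_cond_var M F0 (\<lambda>\<omega>. sgd_grad2 V1 V2 A1 A2 \<alpha> b (\<lambda>s i. X b s i \<omega>) t) \<omega>)"
      using b1(2) b2(2) by eventually_elim (auto elim!: monotone_on_subset)
  qed
qed

end
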